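(* Let $\Omega\subset\mathbb{R}^n$ be a compact subset, and let $f$ be a $C^2$-function on an open neighborhood of $\Omega$ that is convex on this neighborhood and has positive definite Hessian at every point of it. Then $f|_{\Omega}$ can be extended to a $C^2$-function on the convex hull $\Omega^{\mathrm{co}}$ with positive definite Hessian.
   Context: All functions are real valued and never take the values $\pm\infty$. The sets involved are not assumed convex. A function $f$ on $U\subset\mathbb{R}^n$ is called convex if $f(x)\le \lambda_1 f(x_1)+\cdots+\lambda_k f(x_k)$ whenever $x_1,\dots,x_k\in U$, $\lambda_i\ge 0$, $\lambda_1+\cdots+\lambda_k=1$, and the convex combination $x=\lambda_1x_1+\cdots+\lambda_kx_k$ also lies in $U$. The Hessian of a $C^2$-function $f$ is the quadratic form $H_f(v)=\sum_{i,j}\frac{\partial^2 f}{\partial x_i\partial x_j}v_iv_j$. A $C^2$-function on a set that is not open means a function that is $C^2$ on some open set containing that set. *)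

theory Defs
  imports "HOL-Analysis.Analysis"
begin

text \<open>Convexity on a set that need not be convex: Jensen's inequality is required for every convex
  combination of points of the set that happens to lie in the set again. On nonconvex sets,
  combinations of only two points would give a weaker notion, and the library's \<^const>\<open>convex_on\<close>
  requires the domain to be convex.\<close>

definition convex_function_on :: "('a::real_vector) set \<Rightarrow> ('a \<Rightarrow> real) \<Rightarrow> bool" where
  "convex_function_on U f \<longleftrightarrow>
    (\<forall>(k::nat) (c :: nat \<Rightarrow> real) (x :: nat \<Rightarrow> 'a).
      (\<forall>i\<in>{1..k}. x i \<in> U \<and> 0 \<le> c i) \<and> (\<Sum>i=1..k. c i) = 1 \<and> (\<Sum>i=1..k. c i *\<^sub>R x i) \<in> U
      \<longrightarrow> f (\<Sum>i=1..k. c i *\<^sub>R x i) \<le> (\<Sum>i=1..k. c i * f (x i)))"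

definition partial_deriv :: "'n \<Rightarrow> (real ^ 'n \<Rightarrow> real) \<Rightarrow> real ^ 'n \<Rightarrow> real" where
  "partial_deriv i f x = deriv (\<lambda>t. f (x + t *\<^sub>R axis i 1)) 0"

text \<open>Meant for open \<open>U\<close>; the derivative is the Frechet derivative, whose matrix entries are the
  partial derivatives.\<close>

definition C1_on_open :: "(real ^ 'n) set \<Rightarrow> (real ^ 'n \<Rightarrow> real) \<Rightarrow> bool" where
  "C1_on_open U f \<longleftrightarrow>
    (\<forall>x\<in>U. f differentiable (at x)) \<and> (\<forall>i. continuous_on U (partial_deriv i f))"

text \<open>On a set \<open>S\<close> that is not open, twice continuous differentiability refers to some open
  set containing \<open>S\<close>; for open \<open>S\<close> one may take \<open>U = S\<close>.\<close>

definition C2_function_on :: "(real ^ 'n) set \<Rightarrow> (real ^ 'n \<Rightarrow> real) \<Rightarrow> bool" where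
  "C2_function_on S f \<longleftrightarrow>
    (\<exists>U. open U \<and> S \<subseteq> U \<and> C1_on_open U f \<and> (\<forall>i. C1_on_open U (partial_deriv i f)))"

definition hessian :: "(real ^ 'n \<Rightarrow> real) \<Rightarrow> real ^ 'n \<Rightarrow> real ^ 'n \<Rightarrow> real" where
  "hessian f x v =
    (\<Sum>i\<in>UNIV. \<Sum>j\<in>UNIV. partial_deriv i (partial_deriv j f) x * v $ i * v $ j)"

definition positive_definite :: "(real ^ 'n \<Rightarrow> real) \<Rightarrow> bool" where
  "positive_definite Q \<longleftrightarrow> (\<forall>v. v \<noteq> 0 \<longrightarrow> 0 < Q v)"

end

theory Submission
  imports Defs
begin

text \<open>Choose a bounded open \<open>V\<close> with \<open>\<Omega> \<subseteq> V\<close> and \<open>closure V \<subseteq> U\<close>. Since \<open>f\<close> is strictly convex near each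
  \<open>p\<close> in the frontier of \<open>V\<close>, its tangent plane at \<open>p\<close> lies strictly below \<open>f\<close> on \<open>\<Omega>\<close>. Adding a small
  constant and a small multiple of \<open>\<bar>x - p\<bar>\<^sup>2\<close> gives a strongly convex quadratic that is below \<open>f\<close> on
  \<open>\<Omega>\<close> but above \<open>f\<close> near \<open>p\<close>. By compactness finitely many of these dominate \<open>f\<close> on the whole
  frontier. Let \<open>G\<close> be their regularised maximum, where \<open>\<bar>t\<bar>\<close> in \<open>max a b = (a + b + \<bar>a - b\<bar>) / 2\<close> is
  replaced by a convex \<open>C\<^sup>2\<close> function that equals \<open>\<bar>t\<bar>\<close> away from \<open>0\<close>. The regularised maximum of \<open>f\<close>
  and \<open>G\<close> on \<open>V\<close> equals \<open>f\<close> on \<open>\<Omega>\<close> and \<open>G\<close> near the frontier of \<open>V\<close>, so that \<open>G\<close> continues it to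
  the whole space.\<close>

section \<open>Partial derivatives and Frechet derivatives\<close>

lemma partial_deriv_eq:
  fixes f :: "real ^ 'n \<Rightarrow> real"
  assumes "(f has_derivative f') (at x)"
  shows "partial_deriv i f x = f' (axis i 1)"
proof -
  have lin: "linear f'"
    using assms has_derivative_linear by blast
  have "((\<lambda>t::real. x + t *\<^sub>R axis i 1) has_derivative (\<lambda>t. t *\<^sub>R axis i 1)) (at 0)"
    by (auto intro!: derivative_eq_intros)
  moreover have "(f has_derivative f') (at (x + 0 *\<^sub>R axis i 1))"
    using assms by simp
  ultimately have "((\<lambda>t. f (x + t *\<^sub>R axis i 1)) has_derivative (\<lambda>t. f' (t *\<^sub>R axis i 1))) (at 0)"
    by (rule has_derivative_compose)
  then have "((\<lambda>t. f (x + t *\<^sub>R axis i 1)) has_real_derivative f' (axis i 1)) (at 0)"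
    by (simp add: has_field_derivative_def linear_cmul[OF lin] mult_commute_abs)
  then show ?thesis
    unfolding partial_deriv_def by (rule DERIV_imp_deriv)
qed

lemma has_derivative_partial_deriv:
  fixes f :: "real ^ 'n \<Rightarrow> real"
  assumes "f differentiable (at x)"
  shows "(f has_derivative (\<lambda>v. \<Sum>i\<in>UNIV. partial_deriv i f x * v $ i)) (at x)"
proof -
  obtain f' where f': "(f has_derivative f') (at x)"
    using assms unfolding differentiable_def by blast
  then have lin: "linear f'"
    using has_derivative_linear by blast
  have "f' v = (\<Sum>i\<in>UNIV. partial_deriv i f x * v $ i)" for v
  proof -
    have "f' v = f' (\<Sum>i\<in>UNIV. v $ i *\<^sub>R axis i 1)"
      using basis_expansion[of v] by (simp add: scalar_mult_eq_scaleR)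
    also have "\<dots> = (\<Sum>i\<in>UNIV. v $ i *\<^sub>R f' (axis i 1))"
      by (simp add: linear_sum[OF lin] linear_cmul[OF lin])
    finally show ?thesis
      by (simp add: partial_deriv_eq[OF f'] mult.commute)
  qed
  then have "f' = (\<lambda>v. \<Sum>i\<in>UNIV. partial_deriv i f x * v $ i)"
    by blast
  with f' show ?thesis by simp
qed

text \<open>\<open>deriv\<close> at \<open>0\<close> sees only values for small \<open>t\<close>,
  and for these the line through \<open>x\<close> stays in the open set \<open>W\<close>.\<close>

lemma partial_deriv_cong:
  assumes "open W" "x \<in> W" "\<And>y. y \<in> W \<Longrightarrow> f y = g y"
  shows "partial_deriv i f x = partial_deriv i g x"
proof -
  have "((\<lambda>t. x + t *\<^sub>R axis i 1) \<longlongrightarrow> x + 0 *\<^sub>R axis i 1) (nhds (0::real))"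
    by (intro tendsto_intros filterlim_ident)
  then have "\<forall>\<^sub>F t in nhds 0. x + t *\<^sub>R axis i 1 \<in> W"
    using assms(1,2) by (intro topological_tendstoD) simp_all
  then have "\<forall>\<^sub>F t in nhds 0. f (x + t *\<^sub>R axis i 1) = g (x + t *\<^sub>R axis i 1)"
    by eventually_elim (use assms(3) in auto)
  then show ?thesis
    unfolding partial_deriv_def by (intro deriv_cong_ev) auto
qed

text \<open>Lets a gradient be supplied in closed form: evaluating the derivative at the axis
  vectors shows that the supplied \<open>D i\<close> are the partial derivatives.\<close>

lemma C1_on_openI:
  fixes f :: "real ^ 'n \<Rightarrow> real"
  assumes "\<And>x. x \<in> W \<Longrightarrow> (f has_derivative (\<lambda>v. \<Sum>i\<in>UNIV. D i x * v $ i)) (at x)"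
    and "\<And>i. continuous_on W (D i)"
  shows "C1_on_open W f" and "\<And>x i. x \<in> W \<Longrightarrow> partial_deriv i f x = D i x"
proof -
  show *: "partial_deriv i f x = D i x" if "x \<in> W" for x i
    using partial_deriv_eq[OF assms(1)[OF that], of i] inner_axis[of "\<chi> j. D j x" i 1]
    by (simp add: inner_vec_def)
  have "continuous_on W (partial_deriv i f)" for i
    by (rule continuous_on_eq[OF assms(2)]) (simp add: *)
  then show "C1_on_open W f"
    unfolding C1_on_open_def differentiable_def using assms(1) by blast
qed

lemma C1_on_open_cong:
  assumes "open W" "\<And>x. x \<in> W \<Longrightarrow> f x = g x" "C1_on_open W g"
  shows "C1_on_open W f"
proof (rule C1_on_openI)
  show "(f has_derivative (\<lambda>v. \<Sum>i\<in>UNIV. partial_deriv i g x * v $ i)) (at x)" if "x \<in> W" for x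
  proof (rule has_derivative_transform_within_open[OF has_derivative_partial_deriv \<open>open W\<close> that])
    show "g differentiable (at x)"
      using assms(3) that by (simp add: C1_on_open_def)
  qed (use assms(2) in auto)
  show "continuous_on W (partial_deriv i g)" for i
    using assms(3) by (simp add: C1_on_open_def)
qed

section \<open>C2 functions with positive definite Hessian\<close>

text \<open>Meant for open \<open>W\<close>. The set on which the derivatives are controlled is
  fixed to be \<open>W\<close> rather than quantified as in \<open>C2_function_on\<close>, so that
  the property can be restricted and glued.\<close>

definition pos_def_C2_on :: "(real ^ 'n) set \<Rightarrow> (real ^ 'n \<Rightarrow> real) \<Rightarrow> bool" where
  "pos_def_C2_on W f \<longleftrightarrow> C1_on_open W f \<and> (\<forall>i. C1_on_open W (partial_deriv i f))
     \<and> (\<forall>x\<in>W. positive_definite (hessian f x))"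

text \<open>Reduces membership to an explicit gradient \<open>D\<close> and an explicit matrix
  \<open>H\<close> of second derivatives. The first index of \<open>H\<close> is the direction
  differentiated last, as in \<open>hessian\<close>.\<close>

lemma pos_def_C2_onI:
  fixes f :: "real ^ 'n \<Rightarrow> real"
  assumes W: "open W"
    and f: "\<And>x. x \<in> W \<Longrightarrow> (f has_derivative (\<lambda>v. \<Sum>i\<in>UNIV. D i x * v $ i)) (at x)"
    and D: "\<And>x i. x \<in> W \<Longrightarrow> (D i has_derivative (\<lambda>v. \<Sum>j\<in>UNIV. H j i x * v $ j)) (at x)"
    and H: "\<And>i j. continuous_on W (H j i)"
    and pos: "\<And>x v. x \<in> W \<Longrightarrow> v \<noteq> 0 \<Longrightarrow> 0 < (\<Sum>i\<in>UNIV. \<Sum>j\<in>UNIV. H i j x * v $ i * v $ j)"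
  shows "pos_def_C2_on W f"
proof -
  have contD: "continuous_on W (D i)" for i
    by (intro continuous_at_imp_continuous_on ballI has_derivative_continuous[OF D])
  note f' = C1_on_openI[of W f D, OF f contD]
  have D': "C1_on_open W (D i)" "\<And>x j. x \<in> W \<Longrightarrow> partial_deriv j (D i) x = H j i x" for i
    using C1_on_openI[of W "D i" "\<lambda>j. H j i", OF D H] by auto
  have "C1_on_open W (partial_deriv i f)" for i
    by (rule C1_on_open_cong[OF W _ D'(1)]) (use f'(2) in auto)
  moreover have "partial_deriv i (partial_deriv j f) x = H i j x" if "x \<in> W" for x i j
    using partial_deriv_cong[OF W that, of "partial_deriv j f" "D j" i] f'(2) D'(2)[OF that] by simp
  ultimately show ?thesis
    using f'(1) pos unfolding pos_def_C2_on_def positive_definite_def hessian_def by simp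
qed

lemma pos_def_C2_onD:
  fixes f :: "real ^ 'n \<Rightarrow> real"
  assumes "pos_def_C2_on W f" "x \<in> W"
  shows "(f has_derivative (\<lambda>v. \<Sum>i\<in>UNIV. partial_deriv i f x * v $ i)) (at x)"
    and "(partial_deriv i f has_derivative
           (\<lambda>v. \<Sum>j\<in>UNIV. partial_deriv j (partial_deriv i f) x * v $ j)) (at x)"
    and "v \<noteq> 0 \<Longrightarrow>
      0 < (\<Sum>i\<in>UNIV. \<Sum>j\<in>UNIV. partial_deriv i (partial_deriv j f) x * v $ i * v $ j)"
proof -
  have "f differentiable (at x)" "partial_deriv i f differentiable (at x)"
    using assms by (auto simp: pos_def_C2_on_def C1_on_open_def)
  then show "(f has_derivative (\<lambda>v. \<Sum>i\<in>UNIV. partial_deriv i f x * v $ i)) (at x)"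
    and "(partial_deriv i f has_derivative
           (\<lambda>v. \<Sum>j\<in>UNIV. partial_deriv j (partial_deriv i f) x * v $ j)) (at x)"
    by (simp_all add: has_derivative_partial_deriv)
  show "0 < (\<Sum>i\<in>UNIV. \<Sum>j\<in>UNIV. partial_deriv i (partial_deriv j f) x * v $ i * v $ j)" if "v \<noteq> 0"
    using assms that unfolding pos_def_C2_on_def positive_definite_def hessian_def by simp
qed

lemma pos_def_C2_on_continuous_second:
  assumes "pos_def_C2_on W f"
  shows "continuous_on W (partial_deriv j (partial_deriv i f))"
  using assms unfolding pos_def_C2_on_def C1_on_open_def by blast

lemma pos_def_C2_on_continuous:
  assumes "pos_def_C2_on W f"
  shows "continuous_on W f"
  by (intro continuous_at_imp_continuous_on ballI has_derivative_continuous[OF pos_def_C2_onD(1)[OF assms]])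

lemma pos_def_C2_on_subset:
  assumes "pos_def_C2_on W f" "V \<subseteq> W"
  shows "pos_def_C2_on V f"
  using assms continuous_on_subset unfolding pos_def_C2_on_def C1_on_open_def by blast

lemma pos_def_C2_on_cong:
  assumes W: "open W" and eq: "\<And>x. x \<in> W \<Longrightarrow> f x = g x" and g: "pos_def_C2_on W g"
  shows "pos_def_C2_on W f"
proof (rule pos_def_C2_onI[OF W, where D = "\<lambda>i. partial_deriv i g"
      and H = "\<lambda>j i. partial_deriv j (partial_deriv i g)"])
  show "(f has_derivative (\<lambda>v. \<Sum>i\<in>UNIV. partial_deriv i g x * v $ i)) (at x)" if "x \<in> W" for x
    by (rule has_derivative_transform_within_open[OF pos_def_C2_onD(1)[OF g that] W that])
      (use eq in auto)
qed (use pos_def_C2_onD[OF g] pos_def_C2_on_continuous_second[OF g] in auto)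

text \<open>Differentiability, continuity on open sets and positivity can all be checked near each
  point. This is the tool for gluing the pieces of the extension.\<close>

lemma pos_def_C2_on_local:
  fixes f :: "real ^ 'n \<Rightarrow> real"
  assumes "\<And>x. x \<in> S \<Longrightarrow> \<exists>W. open W \<and> x \<in> W \<and> pos_def_C2_on W f"
  shows "pos_def_C2_on S f"
proof -
  have diff: "f differentiable (at x) \<and> (\<forall>i. partial_deriv i f differentiable (at x))
      \<and> positive_definite (hessian f x)"
    and cont: "isCont (partial_deriv i f) x \<and> isCont (partial_deriv i (partial_deriv j f)) x"
    if "x \<in> S" for x i j
  proof -
    obtain W where W: "open W" "x \<in> W" "pos_def_C2_on W f"
      using assms[OF \<open>x \<in> S\<close>] by auto
    then show "f differentiable (at x) \<and> (\<forall>i. partial_deriv i f differentiable (at x))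
        \<and> positive_definite (hessian f x)"
      by (simp add: pos_def_C2_on_def C1_on_open_def)
    have "continuous_on W (partial_deriv i f)" "continuous_on W (partial_deriv i (partial_deriv j f))"
      using W(3) by (simp_all add: pos_def_C2_on_def C1_on_open_def)
    then show "isCont (partial_deriv i f) x \<and> isCont (partial_deriv i (partial_deriv j f)) x"
      using W(1,2) by (simp add: continuous_on_eq_continuous_at)
  qed
  show ?thesis
    unfolding pos_def_C2_on_def C1_on_open_def
    using diff cont by (auto intro!: continuous_at_imp_continuous_on)
qed

text \<open>The Hessian matrix is \<open>2 * d\<close> times the identity.\<close>

lemma pos_def_C2_on_quadratic:
  fixes p a :: "real ^ 'n" and c d :: real
  assumes "d > 0"
  shows "pos_def_C2_on UNIV (\<lambda>x. c + a \<bullet> (x - p) + d * ((x - p) \<bullet> (x - p)))"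
proof (rule pos_def_C2_onI[where D = "\<lambda>i x. a $ i + 2 * d * (x $ i - p $ i)"
      and H = "\<lambda>j i x. if i = j then 2 * d else 0"])
  fix x :: "real ^ 'n"
  show "((\<lambda>x. c + a \<bullet> (x - p) + d * ((x - p) \<bullet> (x - p))) has_derivative
      (\<lambda>v. \<Sum>i\<in>UNIV. (a $ i + 2 * d * (x $ i - p $ i)) * v $ i)) (at x)"
    by (rule has_derivative_eq_rhs, (rule derivative_intros)+)
      (auto simp: fun_eq_iff inner_vec_def sum_distrib_left algebra_simps sum.distrib sum_subtractf)
  show "((\<lambda>x. a $ i + 2 * d * (x $ i - p $ i)) has_derivative
      (\<lambda>v. \<Sum>j\<in>UNIV. (if i = j then 2 * d else 0) * v $ j)) (at x)" for i
    by (auto intro!: derivative_eq_intros bounded_linear_imp_has_derivative[OF bounded_linear_vec_nth]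
        simp: if_distrib if_distribR cong: if_cong)
  fix v :: "real ^ 'n"
  assume "v \<noteq> 0"
  have "(\<Sum>i\<in>UNIV. \<Sum>j\<in>UNIV. (if j = i then 2 * d else 0) * v $ i * v $ j) = 2 * d * (v \<bullet> v)"
    by (simp add: inner_vec_def sum_distrib_left if_distrib if_distribR mult.assoc cong: if_cong)
  also have "\<dots> > 0"
    using assms \<open>v \<noteq> 0\<close> by simp
  finally show "0 < (\<Sum>i\<in>UNIV. \<Sum>j\<in>UNIV. (if j = i then 2 * d else 0) * v $ i * v $ j)" .
qed auto

section \<open>A C2 substitute for the absolute value\<close>

text \<open>The second antiderivative of the hat function \<open>max 0 (1 - \<bar>t\<bar>)\<close>, a cubic spline.\<close>

definition abs_spline :: "real \<Rightarrow> real" where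
  "abs_spline t = (\<bar>t + 1\<bar> ^ 3 - 2 * \<bar>t\<bar> ^ 3 + \<bar>t - 1\<bar> ^ 3) / 6"

definition abs_spline' :: "real \<Rightarrow> real" where
  "abs_spline' t = ((t + 1) * \<bar>t + 1\<bar> - 2 * (t * \<bar>t\<bar>) + (t - 1) * \<bar>t - 1\<bar>) / 2"

definition abs_spline'' :: "real \<Rightarrow> real" where
  "abs_spline'' t = \<bar>t + 1\<bar> - 2 * \<bar>t\<bar> + \<bar>t - 1\<bar>"

text \<open>At \<open>0\<close> the difference quotient is \<open>\<bar>h\<bar>\<close>; near any
  other \<open>t\<close> the function agrees with \<open>sgn t * y\<^sup>2\<close>, because the sign
  is locally constant.\<close>

lemma DERIV_mult_abs: "((\<lambda>t::real. t * \<bar>t\<bar>) has_real_derivative 2 * \<bar>t\<bar>) (at t)"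
proof (cases "t = 0")
  case True
  have "((\<lambda>h::real. \<bar>h\<bar>) \<longlongrightarrow> \<bar>0\<bar>) (at 0)"
    by (intro tendsto_intros)
  then have "((\<lambda>h::real. ((0 + h) * \<bar>0 + h\<bar> - 0 * \<bar>0\<bar>) / h) \<longlongrightarrow> \<bar>0\<bar>) (at 0)"
    by (rule Lim_transform_eventually) (auto simp: eventually_at_filter)
  then show ?thesis
    unfolding True DERIV_def by simp
next
  case False
  have "((\<lambda>y. sgn t * y\<^sup>2) has_real_derivative 2 * \<bar>t\<bar>) (at t)"
    by (auto intro!: derivative_eq_intros simp: abs_sgn)
  moreover have "open {y. 0 < sgn t * y}"
    by (intro open_Collect_less continuous_intros)
  moreover have "t \<in> {y. 0 < sgn t * y}"
    using False by (auto simp: sgn_if)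
  moreover have "sgn t * y\<^sup>2 = y * \<bar>y\<bar>" if "y \<in> {y. 0 < sgn t * y}" for y
    using that by (auto simp: sgn_if power2_eq_square split: if_splits)
  ultimately show ?thesis
    by (rule has_field_derivative_transform_within_open)
qed

lemma DERIV_abs_cubed: "((\<lambda>t::real. \<bar>t\<bar> ^ 3) has_real_derivative 3 * (t * \<bar>t\<bar>)) (at t)"
proof -
  have "((\<lambda>t::real. t * (t * \<bar>t\<bar>)) has_real_derivative 3 * (t * \<bar>t\<bar>)) (at t)"
    by (rule DERIV_cong[OF DERIV_mult[OF DERIV_ident DERIV_mult_abs]]) simp
  then show ?thesis
    by (simp add: power3_eq_cube abs_mult_self_eq flip: mult.assoc)
qed

lemma DERIV_abs_spline: "(abs_spline has_real_derivative abs_spline' t) (at t)"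
proof -
  have "((\<lambda>t. \<bar>t + c\<bar> ^ 3) has_real_derivative 3 * ((t + c) * \<bar>t + c\<bar>)) (at t)" for c t :: real
    by (rule DERIV_shift[THEN iffD1, OF DERIV_abs_cubed])
  note shift = this[of 1] this[of "- 1", simplified]
  show ?thesis
    using DERIV_cdivide[OF DERIV_add[OF DERIV_diff[OF shift(1) DERIV_cmult[OF DERIV_abs_cubed, of 2]]
          shift(2)], of 6 t]
    unfolding abs_spline_def[abs_def] abs_spline'_def by (rule DERIV_cong) simp
qed

lemma DERIV_abs_spline': "(abs_spline' has_real_derivative abs_spline'' t) (at t)"
proof -
  have "((\<lambda>t. (t + c) * \<bar>t + c\<bar>) has_real_derivative 2 * \<bar>t + c\<bar>) (at t)" for c t :: real
    by (rule DERIV_shift[THEN iffD1, OF DERIV_mult_abs])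
  note shift = this[of 1] this[of "- 1", simplified]
  show ?thesis
    using DERIV_cdivide[OF DERIV_add[OF DERIV_diff[OF shift(1) DERIV_cmult[OF DERIV_mult_abs, of 2]]
          shift(2)], of 2 t]
    unfolding abs_spline'_def[abs_def] abs_spline''_def by (rule DERIV_cong) simp
qed

lemma abs_spline''_nonneg: "0 \<le> abs_spline'' t"
  by (simp add: abs_spline''_def abs_if)

text \<open>Here \<open>t - 1\<close>, \<open>t\<close> and \<open>t + 1\<close> do not differ in
  sign, so the numerator is, up to sign, the second difference of a cubic, which is
  \<open>6 * t\<close>.\<close>

lemma abs_spline_outside:
  assumes "1 \<le> \<bar>t\<bar>"
  shows "abs_spline t = \<bar>t\<bar>"
proof (cases "0 \<le> t")
  case True
  then have "\<bar>t\<bar> = t" "\<bar>t + 1\<bar> = t + 1" "\<bar>t - 1\<bar> = t - 1"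
    using assms by auto
  then show ?thesis
    by (simp add: abs_spline_def power3_eq_cube field_simps)
next
  case False
  then have "\<bar>t\<bar> = - t" "\<bar>t + 1\<bar> = - t - 1" "\<bar>t - 1\<bar> = 1 - t"
    using assms by auto
  then show ?thesis
    by (simp add: abs_spline_def power3_eq_cube field_simps)
qed

text \<open>This form isolates the excess over \<open>\<bar>t\<bar>\<close>, from which the bounds
  below are read off.\<close>

lemma abs_spline_inside:
  assumes "\<bar>t\<bar> \<le> 1"
  shows "abs_spline t = \<bar>t\<bar> + (1 - \<bar>t\<bar>) ^ 3 / 3"
proof -
  have "\<bar>t + 1\<bar> = t + 1" "\<bar>t - 1\<bar> = 1 - t"
    using assms by auto
  then show ?thesis
    by (cases "0 \<le> t") (simp_all add: abs_spline_def power3_eq_cube field_simps)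
qed

lemma abs_spline_bounds: "\<bar>t\<bar> \<le> abs_spline t" "abs_spline t \<le> \<bar>t\<bar> + 1"
proof -
  have "0 \<le> (1 - \<bar>t\<bar>) ^ 3 / 3 \<and> (1 - \<bar>t\<bar>) ^ 3 / 3 \<le> 1" if "\<bar>t\<bar> \<le> 1"
    using that power_le_one[of "1 - \<bar>t\<bar>" 3] by auto
  then show "\<bar>t\<bar> \<le> abs_spline t" "abs_spline t \<le> \<bar>t\<bar> + 1"
    using abs_spline_inside[of t] abs_spline_outside[of t] by (cases "\<bar>t\<bar> \<le> 1"; simp)+
qed

text \<open>The derivative is nondecreasing, since \<open>abs_spline''\<close> is nonnegative, and
  it is constantly \<open>-1\<close> left of \<open>-1\<close> and \<open>1\<close> right of
  \<open>1\<close>. The bound makes the weights in the gradient of the regularised maximum lie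
  between \<open>0\<close> and \<open>1\<close>.\<close>

lemma abs_spline'_bounds: "\<bar>abs_spline' t\<bar> \<le> 1"
proof -
  have mono: "abs_spline' s \<le> abs_spline' t" if "s \<le> t" for s t
    using that DERIV_abs_spline' abs_spline''_nonneg by (blast intro: DERIV_nonneg_imp_nondecreasing)
  have "abs_spline' t \<le> 1"
    using mono[of t "max 1 t"] by (auto simp: abs_spline'_def max_def algebra_simps split: if_splits)
  moreover have "- 1 \<le> abs_spline' t"
    using mono[of "min (- 1) t" t] by (auto simp: abs_spline'_def min_def algebra_simps split: if_splits)
  ultimately show ?thesis by simp
qed

section \<open>The regularised maximum\<close>

text \<open>Rescaling the spline by \<open>\<epsilon>\<close> confines the smoothing to
  \<open>\<bar>a - b\<bar> < \<epsilon>\<close>.\<close>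

definition reg_max :: "real \<Rightarrow> real \<Rightarrow> real \<Rightarrow> real" where
  "reg_max \<epsilon> a b = (a + b + \<epsilon> * abs_spline ((a - b) / \<epsilon>)) / 2"

lemma reg_max_eq:
  assumes "\<epsilon> > 0"
  shows "a \<ge> b + \<epsilon> \<Longrightarrow> reg_max \<epsilon> a b = a" "b \<ge> a + \<epsilon> \<Longrightarrow> reg_max \<epsilon> a b = b"
  using assms by (simp_all add: reg_max_def abs_spline_outside abs_if field_simps)

text \<open>The rescaled spline exceeds \<open>\<bar>a - b\<bar>\<close> by at least
  \<open>0\<close> and at most \<open>\<epsilon>\<close>.\<close>

lemma reg_max_bounds:
  assumes "\<epsilon> > 0"
  shows "max a b \<le> reg_max \<epsilon> a b" "reg_max \<epsilon> a b \<le> max a b + \<epsilon>"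
proof -
  have "\<epsilon> * \<bar>(a - b) / \<epsilon>\<bar> = \<bar>a - b\<bar>"
    using assms by simp
  moreover have "\<epsilon> * \<bar>(a - b) / \<epsilon>\<bar> \<le> \<epsilon> * abs_spline ((a - b) / \<epsilon>)"
    and "\<epsilon> * abs_spline ((a - b) / \<epsilon>) \<le> \<epsilon> * (\<bar>(a - b) / \<epsilon>\<bar> + 1)"
    using assms abs_spline_bounds by (simp_all add: mult_left_mono del: abs_divide)
  ultimately show "max a b \<le> reg_max \<epsilon> a b" "reg_max \<epsilon> a b \<le> max a b + \<epsilon>"
    using assms unfolding reg_max_def by (auto simp: distrib_left max_def abs_if split: if_splits)
qed

text \<open>The Hessian of the regularised maximum is a convex combination of the two Hessians plus a
  nonnegative multiple of the square of the difference of the gradients.\<close>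

lemma pos_def_C2_on_reg_max:
  fixes f g :: "real ^ 'n \<Rightarrow> real"
  assumes W: "open W" and \<epsilon>: "\<epsilon> > 0" and f: "pos_def_C2_on W f" and g: "pos_def_C2_on W g"
  shows "pos_def_C2_on W (\<lambda>x. reg_max \<epsilon> (f x) (g x))"
proof -
  \<comment> \<open>\<open>s\<close> is the partial derivative of \<open>reg_max \<epsilon>\<close>
    in its first argument and \<open>1 - s\<close> the one in its second; \<open>r\<close> is the
    derivative of \<open>s\<close> in the first argument.\<close>
  define s where "s x = (1 + abs_spline' ((f x - g x) / \<epsilon>)) / 2" for x
  define r where "r x = abs_spline'' ((f x - g x) / \<epsilon>) / (2 * \<epsilon>)" for x
  let ?d = "\<lambda>i x. partial_deriv i f x - partial_deriv i g x"
  have s01: "0 \<le> s x" "s x \<le> 1" for x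
    using abs_spline'_bounds[of "(f x - g x) / \<epsilon>"] by (auto simp: s_def)
  have r0: "0 \<le> r x" for x
    using \<epsilon> abs_spline''_nonneg by (simp add: r_def)
  have deriv_diff: "((\<lambda>x. (f x - g x) / \<epsilon>) has_derivative
      (\<lambda>v. (\<Sum>i\<in>UNIV. ?d i x * v $ i) / \<epsilon>)) (at x)" if "x \<in> W" for x
    using \<epsilon> by (auto intro!: derivative_eq_intros pos_def_C2_onD(1)[OF f that] pos_def_C2_onD(1)[OF g that]
        simp: sum_subtractf algebra_simps diff_divide_distrib)
  have deriv_s: "(s has_derivative (\<lambda>v. r x * (\<Sum>i\<in>UNIV. ?d i x * v $ i))) (at x)" if "x \<in> W" for x
  proof -
    have "((\<lambda>x. abs_spline' ((f x - g x) / \<epsilon>)) has_derivative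
        (\<lambda>v. abs_spline'' ((f x - g x) / \<epsilon>) * ((\<Sum>i\<in>UNIV. ?d i x * v $ i) / \<epsilon>))) (at x)"
      by (rule has_derivative_compose[OF deriv_diff[OF that]
            DERIV_abs_spline'[unfolded has_field_derivative_def]])
    then show ?thesis
      unfolding s_def r_def using \<epsilon> by (auto intro!: derivative_eq_intros simp: field_simps)
  qed
  show ?thesis
  proof (rule pos_def_C2_onI[OF W, where D = "\<lambda>i x. s x * partial_deriv i f x + (1 - s x) * partial_deriv i g x"
        and H = "\<lambda>j i x. s x * partial_deriv j (partial_deriv i f) x
          + (1 - s x) * partial_deriv j (partial_deriv i g) x + r x * (?d j x * ?d i x)"])
    fix x assume x: "x \<in> W"
    note f' = pos_def_C2_onD[OF f x] and g' = pos_def_C2_onD[OF g x]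
    have "((\<lambda>x. abs_spline ((f x - g x) / \<epsilon>)) has_derivative
        (\<lambda>v. abs_spline' ((f x - g x) / \<epsilon>) * ((\<Sum>i\<in>UNIV. ?d i x * v $ i) / \<epsilon>))) (at x)"
      by (rule has_derivative_compose[OF deriv_diff[OF x]
            DERIV_abs_spline[unfolded has_field_derivative_def]])
    then have "((\<lambda>x. 1 / 2 * (f x + g x + \<epsilon> * abs_spline ((f x - g x) / \<epsilon>))) has_derivative
        (\<lambda>v. 1 / 2 * ((\<Sum>i\<in>UNIV. partial_deriv i f x * v $ i) + (\<Sum>i\<in>UNIV. partial_deriv i g x * v $ i)
          + \<epsilon> * (abs_spline' ((f x - g x) / \<epsilon>) * ((\<Sum>i\<in>UNIV. ?d i x * v $ i) / \<epsilon>))))) (at x)"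
      by (intro has_derivative_mult_right has_derivative_add f'(1) g'(1))
    moreover have "1 / 2 * ((\<Sum>i\<in>UNIV. partial_deriv i f x * v $ i) + (\<Sum>i\<in>UNIV. partial_deriv i g x * v $ i)
          + \<epsilon> * (abs_spline' ((f x - g x) / \<epsilon>) * ((\<Sum>i\<in>UNIV. ?d i x * v $ i) / \<epsilon>)))
        = (\<Sum>i\<in>UNIV. (s x * partial_deriv i f x + (1 - s x) * partial_deriv i g x) * v $ i)" for v
    proof -
      have "\<epsilon> * (abs_spline' ((f x - g x) / \<epsilon>) * ((\<Sum>i\<in>UNIV. ?d i x * v $ i) / \<epsilon>))
          = (2 * s x - 1) * (\<Sum>i\<in>UNIV. ?d i x * v $ i)"
        using \<epsilon> by (simp add: s_def field_simps)
      then show ?thesis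
        by (simp only: sum_distrib_left sum.distrib[symmetric])
          (intro sum.cong refl, simp add: field_simps)
    qed
    ultimately show "((\<lambda>x. reg_max \<epsilon> (f x) (g x)) has_derivative
        (\<lambda>v. \<Sum>i\<in>UNIV. (s x * partial_deriv i f x + (1 - s x) * partial_deriv i g x) * v $ i)) (at x)"
      by (simp add: reg_max_def)
    show "((\<lambda>x. s x * partial_deriv i f x + (1 - s x) * partial_deriv i g x) has_derivative
        (\<lambda>v. \<Sum>j\<in>UNIV. (s x * partial_deriv j (partial_deriv i f) x
          + (1 - s x) * partial_deriv j (partial_deriv i g) x + r x * (?d j x * ?d i x)) * v $ j)) (at x)" for i
      by (auto intro!: derivative_eq_intros deriv_s[OF x] f'(2) g'(2) simp: fun_eq_iff algebra_simps
          sum.distrib sum_subtractf sum_distrib_left)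
    fix v :: "real ^ 'n" assume v: "v \<noteq> 0"
    define F where "F = (\<Sum>i\<in>UNIV. \<Sum>j\<in>UNIV. partial_deriv i (partial_deriv j f) x * v $ i * v $ j)"
    define G where "G = (\<Sum>i\<in>UNIV. \<Sum>j\<in>UNIV. partial_deriv i (partial_deriv j g) x * v $ i * v $ j)"
    \<comment> \<open>The rank-one matrix formed from the gradient difference gives the square of a
      linear form.\<close>
    have sq: "(\<Sum>i\<in>UNIV. \<Sum>j\<in>UNIV. (?d i x * ?d j x) * v $ i * v $ j) = (\<Sum>i\<in>UNIV. ?d i x * v $ i)\<^sup>2"
      unfolding power2_eq_square sum_product by (intro sum.cong refl) (simp add: algebra_simps)
    have "(\<Sum>i\<in>UNIV. \<Sum>j\<in>UNIV. (s x * partial_deriv i (partial_deriv j f) x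
          + (1 - s x) * partial_deriv i (partial_deriv j g) x + r x * (?d i x * ?d j x)) * v $ i * v $ j)
        = s x * F + (1 - s x) * G + r x * (\<Sum>i\<in>UNIV. ?d i x * v $ i)\<^sup>2"
      unfolding F_def G_def sq[symmetric] sum_distrib_left sum.distrib[symmetric]
      by (intro sum.cong refl) (simp add: algebra_simps)
    \<comment> \<open>The weights are nonnegative with sum \<open>1\<close>, so at least one of them
      is positive.\<close>
    moreover have "0 < s x * F + (1 - s x) * G"
    proof (cases "s x = 0")
      case False
      then have "0 < s x * F" "0 \<le> (1 - s x) * G"
        using f'(3)[OF v] g'(3)[OF v] s01[of x] by (auto simp: F_def G_def less_le)
      then show ?thesis by linarith
    qed (use g'(3)[OF v] in \<open>simp add: G_def\<close>)
    moreover have "0 \<le> r x * (\<Sum>i\<in>UNIV. ?d i x * v $ i)\<^sup>2"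
      using r0 by simp
    ultimately show "0 < (\<Sum>i\<in>UNIV. \<Sum>j\<in>UNIV. (s x * partial_deriv i (partial_deriv j f) x
          + (1 - s x) * partial_deriv i (partial_deriv j g) x + r x * (?d i x * ?d j x)) * v $ i * v $ j)"
      by linarith
  next
    fix i j
    have "continuous_on W s"
      by (intro continuous_at_imp_continuous_on ballI has_derivative_continuous[OF deriv_s])
    moreover have "continuous_on W r"
      unfolding r_def abs_spline''_def using \<epsilon>
      by (intro continuous_intros pos_def_C2_on_continuous f g) auto
    moreover have "continuous_on W (partial_deriv k f)" "continuous_on W (partial_deriv k g)" for k
      using f g by (simp_all add: pos_def_C2_on_def C1_on_open_def)
    ultimately show "continuous_on W (\<lambda>x. s x * partial_deriv j (partial_deriv i f) x
          + (1 - s x) * partial_deriv j (partial_deriv i g) x + r x * (?d j x * ?d i x))"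
      by (intro continuous_intros pos_def_C2_on_continuous_second f g)
  qed
qed

section \<open>Strict tangent planes\<close>

text \<open>The positive second derivative lifts \<open>f\<close> strictly above the tangent plane a
  short way from \<open>p\<close> towards \<open>y\<close>. Jensen's inequality for
  \<open>p\<close>, \<open>y\<close> and that nearby point carries the strict gap over to
  \<open>y\<close>, even if the segment leaves \<open>U\<close> in between.\<close>

lemma tangent_less:
  fixes f :: "real ^ 'n \<Rightarrow> real"
  assumes U: "open U" and f: "pos_def_C2_on U f" and conv: "convex_function_on U f"
    and p: "p \<in> U" and y: "y \<in> U" and "y \<noteq> p"
  shows "f p + (\<Sum>i\<in>UNIV. partial_deriv i f p * (y - p) $ i) < f y"
proof -
  let ?v = "y - p"
  define D where "D t = (\<Sum>i\<in>UNIV. partial_deriv i f (p + t *\<^sub>R ?v) * ?v $ i)" for t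
  have line: "((\<lambda>t. p + t *\<^sub>R ?v) has_derivative (\<lambda>t. t *\<^sub>R ?v)) (at t)" for t :: real
    by (auto intro!: derivative_eq_intros)
  \<comment> \<open>\<open>U\<close> need not be convex, so only a short piece of the line around
    \<open>p\<close> is known to lie in \<open>U\<close>.\<close>
  have "continuous (at 0) (\<lambda>t::real. p + t *\<^sub>R ?v)"
    by (intro continuous_intros)
  then obtain d where d: "d > 0" and inU: "\<And>t. \<bar>t\<bar> < d \<Longrightarrow> p + t *\<^sub>R ?v \<in> U"
    using U p unfolding continuous_at_open
    by (metis (no_types, lifting) add.right_neutral dist_real_def diff_zero open_dist scaleR_zero_left)
  have f1: "((\<lambda>t. f (p + t *\<^sub>R ?v)) has_real_derivative D t) (at t)" if "\<bar>t\<bar> < d" for t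
  proof -
    have "((\<lambda>t. f (p + t *\<^sub>R ?v)) has_derivative
        (\<lambda>h. \<Sum>i\<in>UNIV. partial_deriv i f (p + t *\<^sub>R ?v) * (h *\<^sub>R ?v) $ i)) (at t)"
      by (rule has_derivative_compose[OF line pos_def_C2_onD(1)[OF f inU[OF that]]])
    then show ?thesis
      unfolding has_field_derivative_def D_def
      by (rule has_derivative_eq_rhs) (simp add: fun_eq_iff sum_distrib_left algebra_simps)
  qed
  let ?Q = "\<Sum>j\<in>UNIV. \<Sum>i\<in>UNIV. partial_deriv j (partial_deriv i f) p * ?v $ j * ?v $ i"
  have "(D has_real_derivative ?Q) (at 0)"
  proof -
    have "((\<lambda>t. partial_deriv i f (p + t *\<^sub>R ?v)) has_derivative
        (\<lambda>h. \<Sum>j\<in>UNIV. partial_deriv j (partial_deriv i f) p * (h *\<^sub>R ?v) $ j)) (at 0)" for i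
      using has_derivative_compose[OF line pos_def_C2_onD(2)[OF f inU, of 0 i]] d by simp
    then have "(D has_derivative (\<lambda>h. \<Sum>i\<in>UNIV.
        (\<Sum>j\<in>UNIV. partial_deriv j (partial_deriv i f) p * (h *\<^sub>R ?v) $ j) * ?v $ i)) (at 0)"
      unfolding D_def by (intro has_derivative_sum has_derivative_mult_left)
    moreover have "(\<Sum>i\<in>UNIV.
        (\<Sum>j\<in>UNIV. partial_deriv j (partial_deriv i f) p * (h *\<^sub>R ?v) $ j) * ?v $ i) = ?Q * h" for h
      unfolding sum_distrib_right by (subst sum.swap) (simp add: algebra_simps)
    ultimately show ?thesis
      unfolding has_field_derivative_def by (auto elim: has_derivative_eq_rhs)
  qed
  moreover have "0 < ?Q"
    using pos_def_C2_onD(3)[OF f p, of ?v] \<open>y \<noteq> p\<close> by simp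
  ultimately obtain e where e: "e > 0" and D_inc: "\<And>h. 0 < h \<Longrightarrow> h < e \<Longrightarrow> D 0 < D h"
    using DERIV_pos_inc_right[of D ?Q 0] by auto
  \<comment> \<open>Below \<open>d\<close> the point lies in \<open>U\<close>, below
    \<open>e\<close> the slope exceeds \<open>D 0\<close>, and below \<open>1\<close> it is a proper
    convex combination of \<open>p\<close> and \<open>y\<close>.\<close>
  define t where "t = min (min d e) 1 / 2"
  have t: "0 < t" "t < d" "t < e" "t < 1"
    using d e by (auto simp: t_def)
  have "\<exists>z>0. z < t \<and> f (p + t *\<^sub>R ?v) - f (p + 0 *\<^sub>R ?v) = (t - 0) * D z"
    by (rule MVT2) (use t f1 in auto)
  then obtain z where z: "0 < z" "z < t" "f (p + t *\<^sub>R ?v) - f p = t * D z"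
    by auto
  have "t * D 0 < t * D z"
    using D_inc[of z] z t by simp
  then have "f p + t * D 0 < f (p + t *\<^sub>R ?v)"
    using z(3) by linarith
  also have "f (p + t *\<^sub>R ?v) \<le> (1 - t) * f p + t * f y"
  proof -
    have eq: "p + t *\<^sub>R ?v = (1 - t) *\<^sub>R p + t *\<^sub>R y"
      by (simp add: algebra_simps)
    have "(1 - t) *\<^sub>R p + t *\<^sub>R y \<in> U"
      using inU[of t] t by (simp add: eq)
    \<comment> \<open>Jensen with \<open>k = 2\<close>: index \<open>1\<close> carries
      \<open>p\<close> with weight \<open>1 - t\<close>, index \<open>2\<close> carries
      \<open>y\<close> with weight \<open>t\<close>.\<close>
    then show ?thesis
      using conv[unfolded convex_function_on_def, rule_format, of 2
          "\<lambda>i. if i = 1 then p else y" "\<lambda>i. if i = 1 then 1 - t else t"] p y t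
      by (simp add: eq numeral_2_eq_2)
  qed
  finally have "t * D 0 < t * (f y - f p)"
    by (simp add: algebra_simps)
  then show ?thesis
    using t by (simp add: D_def)
qed

section \<open>Quadratics below \<open>f\<close> on a compact set, and a common upper bound for
  them\<close>

lemma compact_pos_gap:
  fixes h :: "'a::topological_space \<Rightarrow> real"
  assumes "compact K" "continuous_on K h" "\<And>x. x \<in> K \<Longrightarrow> 0 < h x"
  obtains e where "e > 0" "\<And>x. x \<in> K \<Longrightarrow> e \<le> h x"
proof (cases "K = {}")
  case True
  then show ?thesis using that[of 1] by auto
next
  case False
  then obtain x0 where "x0 \<in> K" "\<And>x. x \<in> K \<Longrightarrow> h x0 \<le> h x"
    using continuous_attains_inf[OF assms(1) _ assms(2)] by blast
  then show ?thesis using that[of "h x0"] assms(3) by auto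
qed

text \<open>Applied with \<open>c = f p\<close> and \<open>a\<close> the gradient of
  \<open>f\<close> at \<open>p\<close>. By compactness the plane stays a fixed distance below
  \<open>f\<close> on \<open>K\<close>, which leaves room both to raise it and to bend it
  upwards.\<close>

lemma exists_quadratic_between:
  fixes f :: "real ^ 'n \<Rightarrow> real"
  assumes K: "compact K" and contf: "continuous_on K f"
    and tangent: "\<And>y. y \<in> K \<Longrightarrow> c + a \<bullet> (y - p) < f y"
  obtains q where "pos_def_C2_on UNIV q" "\<And>y. y \<in> K \<Longrightarrow> q y < f y" "c < q p"
proof -
  obtain e where e: "e > 0" "\<And>y. y \<in> K \<Longrightarrow> e \<le> f y - (c + a \<bullet> (y - p))"
    by (rule compact_pos_gap[OF K, of "\<lambda>y. f y - (c + a \<bullet> (y - p))"])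
      (auto intro!: continuous_intros contf dest: tangent)
  have "bounded ((\<lambda>y. (y - p) \<bullet> (y - p)) ` K)"
    by (intro compact_imp_bounded compact_continuous_image K continuous_intros)
  then obtain B where B: "B > 0" "\<And>y. y \<in> K \<Longrightarrow> (y - p) \<bullet> (y - p) \<le> B"
    unfolding bounded_pos by auto
  \<comment> \<open>The gap \<open>e\<close> is split into thirds: one raises the plane, one bounds
    the quadratic term on \<open>K\<close>, one remains as slack.\<close>
  let ?q = "\<lambda>x. (c + e / 3) + a \<bullet> (x - p) + e / (3 * B) * ((x - p) \<bullet> (x - p))"
  show thesis
  proof (rule that[of ?q])
    show "pos_def_C2_on UNIV ?q"
      by (rule pos_def_C2_on_quadratic) (use e B in simp)
    show "?q y < f y" if "y \<in> K" for y
    proof -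
      have "e / (3 * B) * ((y - p) \<bullet> (y - p)) \<le> e / (3 * B) * B"
        using e B that by (intro mult_left_mono) auto
      also have "\<dots> = e / 3"
        using B(1) by simp
      finally show ?thesis
        using e(1) e(2)[OF that] by linarith
    qed
  qed (use e in simp)
qed

text \<open>Each induction step takes the regularised maximum of the new function and the previous
  bound, with a smoothing width smaller than their distance from \<open>f\<close> on
  \<open>K\<close>.\<close>

lemma exists_pos_def_C2_upper_bound:
  fixes f :: "real ^ 'n \<Rightarrow> real"
  assumes "finite P" and K: "compact K" and contf: "continuous_on K f"
    and q: "\<And>p. p \<in> P \<Longrightarrow> pos_def_C2_on UNIV (q p)"
    and less: "\<And>p y. p \<in> P \<Longrightarrow> y \<in> K \<Longrightarrow> q p y < f y"
  shows "\<exists>G. pos_def_C2_on UNIV G \<and> (\<forall>y\<in>K. G y < f y) \<and> (\<forall>p\<in>P. \<forall>x. q p x \<le> G x)"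
  using assms(1) q less
proof (induction P rule: finite_induct)
  case empty
  have "bounded (f ` K)"
    by (intro compact_imp_bounded compact_continuous_image K contf)
  then obtain B where B: "\<And>y. y \<in> K \<Longrightarrow> \<bar>f y\<bar> \<le> B"
    unfolding bounded_pos by auto
  \<comment> \<open>With no functions to dominate, a positive definite function below
    \<open>f\<close> is still required; it is obtained from a constant below the minimum of
    \<open>f\<close> on \<open>K\<close>.\<close>
  have "- B - 1 + 0 \<bullet> (y - (0::real ^ 'n)) < f y" if "y \<in> K" for y
    using B[OF that] by simp
  from exists_quadratic_between[OF K contf this] show ?case
    by (metis empty_iff)
next
  case (insert p P)
  then obtain G where G: "pos_def_C2_on UNIV G" "\<forall>y\<in>K. G y < f y" "\<forall>p\<in>P. \<forall>x. q p x \<le> G x"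
    by (metis insertCI)
  have qp: "pos_def_C2_on UNIV (q p)" "\<And>y. y \<in> K \<Longrightarrow> q p y < f y"
    using insert.prems by auto
  have "continuous_on K (\<lambda>x. f x - max (q p x) (G x))"
    using pos_def_C2_on_continuous[OF G(1)] pos_def_C2_on_continuous[OF qp(1)]
    by (intro continuous_intros contf) (auto intro: continuous_on_subset)
  then obtain e where e: "e > 0" "\<And>x. x \<in> K \<Longrightarrow> e \<le> f x - max (q p x) (G x)"
    by (rule compact_pos_gap[OF K]) (use G(2) qp(2) in auto)
  \<comment> \<open>Smoothing raises the maximum by at most \<open>e / 2\<close>, half of its
    distance from \<open>f\<close>.\<close>
  let ?M = "\<lambda>x. reg_max (e / 2) (q p x) (G x)"
  have "pos_def_C2_on UNIV ?M"
    by (rule pos_def_C2_on_reg_max) (use e G(1) qp(1) in auto)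
  moreover have "?M y < f y" if "y \<in> K" for y
    using e(1) e(2)[OF that] reg_max_bounds(2)[of "e / 2" "q p y" "G y"] by simp
  moreover have "q p x \<le> ?M x" "G x \<le> ?M x" for x
    using e(1) reg_max_bounds(1)[of "e / 2" "q p x" "G x"] by simp_all
  moreover have "q p' x \<le> ?M x" if "p' \<in> P" for p' x
    by (rule order_trans[OF _ \<open>G x \<le> ?M x\<close>]) (use G(3) that in blast)
  ultimately show ?case
    by (intro exI[of _ ?M]) auto
qed

section \<open>Construction of the extension\<close>

text \<open>Finitely many balls of one radius cover \<open>K\<close>, and the closed balls with the
  same centres and radius form a compact set still inside \<open>U\<close>.\<close>

lemma compact_open_neighbourhood:
  fixes K U :: "'a::heine_borel set"
  assumes "compact K" "open U" "K \<subseteq> U"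
  obtains V where "open V" "K \<subseteq> V" "compact (closure V)" "closure V \<subseteq> U"
proof -
  obtain e where e: "e > 0" "(\<Union>x\<in>K. cball x e) \<subseteq> U"
    using compact_subset_open_imp_cball_epsilon_subset[OF assms] by blast
  obtain C where C: "C \<subseteq> K" "finite C" "K \<subseteq> (\<Union>x\<in>C. ball x e)"
    by (rule compactE_image[OF assms(1), of K "\<lambda>x. ball x e"]) (use e(1) in auto)
  have compact: "compact (\<Union>x\<in>C. cball x e)"
    using C(2) by (intro compact_UN) auto
  have closure: "closure (\<Union>x\<in>C. ball x e) \<subseteq> (\<Union>x\<in>C. cball x e)"
    by (intro closure_minimal compact_imp_closed[OF compact]) (use ball_subset_cball in blast)
  show thesis
  proof (rule that)
    show "compact (closure (\<Union>x\<in>C. ball x e))"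
      using compact_Int_closed[OF compact closed_closure] closure by (metis Int_absorb1)
    show "closure (\<Union>x\<in>C. ball x e) \<subseteq> U"
      using closure C(1) e(2) by blast
  qed (use C(3) in auto)
qed

theorem theorem3p2:
  fixes \<Omega> U :: "(real ^ 'n) set" and f :: "real ^ 'n \<Rightarrow> real"
  assumes "compact \<Omega>"
    and "open U" and "\<Omega> \<subseteq> U"
    and "C2_function_on U f"
    and "convex_function_on U f"
    and "\<forall>x\<in>U. positive_definite (hessian f x)"
  shows "\<exists>g. C2_function_on (convex hull \<Omega>) g
           \<and> (\<forall>x\<in>\<Omega>. g x = f x)
           \<and> (\<forall>x\<in>convex hull \<Omega>. positive_definite (hessian g x))"
proof -
  \<comment> \<open>\<open>C2_function_on\<close> supplies an open set possibly larger than
    \<open>U\<close>, whereas positivity of the Hessian is given on \<open>U\<close>.\<close>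
  obtain U' where "U \<subseteq> U'" "C1_on_open U' f" "\<forall>i. C1_on_open U' (partial_deriv i f)"
    using assms(4) unfolding C2_function_on_def by blast
  then have f: "pos_def_C2_on U f"
    using assms(6) by (auto simp: pos_def_C2_on_def C1_on_open_def
        intro!: continuous_on_subset[OF _ \<open>U \<subseteq> U'\<close>])
  note contf = pos_def_C2_on_continuous[OF f]
  obtain V where V: "open V" "\<Omega> \<subseteq> V" "compact (closure V)" "closure V \<subseteq> U"
    using compact_open_neighbourhood[OF assms(1-3)] by blast
  have frontier: "compact (frontier V)" "frontier V \<subseteq> U" "frontier V \<inter> V = {}"
    using V by (auto simp: frontier_def interior_open compact_diff)
  have cont\<Omega>: "continuous_on \<Omega> f"
    by (rule continuous_on_subset[OF contf assms(3)])
  have "\<exists>q. pos_def_C2_on UNIV q \<and> (\<forall>y\<in>\<Omega>. q y < f y) \<and> f p < q p" if p: "p \<in> frontier V" for p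
  proof -
    have "f p + (\<chi> i. partial_deriv i f p) \<bullet> (y - p) < f y" if "y \<in> \<Omega>" for y
      using tangent_less[OF assms(2) f assms(5), of p y] that p frontier assms(3) V(2)
      by (auto simp: inner_vec_def)
    from exists_quadratic_between[OF assms(1) cont\<Omega> this] show ?thesis
      by metis
  qed
  then obtain q where q: "\<And>p. p \<in> frontier V \<Longrightarrow>
      pos_def_C2_on UNIV (q p) \<and> (\<forall>y\<in>\<Omega>. q p y < f y) \<and> f p < q p p"
    by metis
  have open_less: "open {x \<in> U. f x < h x}" if "pos_def_C2_on UNIV h" for h
  proof -
    have "continuous_on U h"
      using continuous_on_subset[OF pos_def_C2_on_continuous[OF that]] by simp
    then have "open (U \<inter> (\<lambda>x. h x - f x) -` {0<..})"
      by (intro continuous_open_preimage continuous_intros contf assms(2)) auto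
    moreover have "U \<inter> (\<lambda>x. h x - f x) -` {0<..} = {x \<in> U. f x < h x}"
      by auto
    ultimately show ?thesis by simp
  qed
  obtain P where P: "P \<subseteq> frontier V" "finite P" "frontier V \<subseteq> (\<Union>p\<in>P. {x \<in> U. f x < q p x})"
  proof (rule compactE_image[OF frontier(1), of "frontier V" "\<lambda>p. {x \<in> U. f x < q p x}"])
    show "open {x \<in> U. f x < q p x}" if "p \<in> frontier V" for p
      using open_less q[OF that] by simp
    show "frontier V \<subseteq> (\<Union>p\<in>frontier V. {x \<in> U. f x < q p x})"
      using q frontier(2) by fastforce
  qed
  obtain G where G: "pos_def_C2_on UNIV G" "\<forall>y\<in>\<Omega>. G y < f y" "\<forall>p\<in>P. \<forall>x. q p x \<le> G x"
  proof -
    have "\<And>p. p \<in> P \<Longrightarrow> pos_def_C2_on UNIV (q p)" "\<And>p y. p \<in> P \<Longrightarrow> y \<in> \<Omega> \<Longrightarrow> q p y < f y"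
      using q P(1) by auto
    from exists_pos_def_C2_upper_bound[where q = q, OF P(2) assms(1) cont\<Omega> this] that show thesis
      by metis
  qed
  have contG: "continuous_on S G" for S
    using continuous_on_subset[OF pos_def_C2_on_continuous[OF G(1)]] by simp
  have G_frontier: "f x < G x" if "x \<in> frontier V" for x
  proof -
    obtain p where "p \<in> P" "f x < q p x"
      using subsetD[OF P(3) \<open>x \<in> frontier V\<close>] by auto
    then show ?thesis
      using G(3) by (meson less_le_trans)
  qed
  obtain e1 where e1: "e1 > 0" "\<And>x. x \<in> \<Omega> \<Longrightarrow> e1 \<le> f x - G x"
    by (rule compact_pos_gap[OF assms(1), of "\<lambda>x. f x - G x"])
      (use G(2) in \<open>auto intro!: continuous_intros cont\<Omega> contG\<close>)
  obtain e2 where e2: "e2 > 0" "\<And>x. x \<in> frontier V \<Longrightarrow> e2 \<le> G x - f x"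
    by (rule compact_pos_gap[OF frontier(1), of "\<lambda>x. G x - f x"])
      (use G_frontier frontier(2) in \<open>auto intro!: continuous_intros contG continuous_on_subset[OF contf]\<close>)
  \<comment> \<open>The width is below both gaps, so the regularised maximum returns
    \<open>f\<close> on \<open>\<Omega>\<close> and \<open>G\<close> near the frontier of
    \<open>V\<close>.\<close>
  define e where "e = min e1 e2 / 2"
  have e: "e > 0" "e < e1" "e < e2"
    using e1 e2 by (auto simp: e_def)
  define g where "g x = (if x \<in> V then reg_max e (f x) (G x) else G x)" for x
  have g_pd: "pos_def_C2_on UNIV g"
  proof (rule pos_def_C2_on_local)
    fix x
    consider "x \<in> V" | "x \<in> - closure V" | "x \<in> frontier V"
      using V(1) by (auto simp: frontier_def interior_open)
    then show "\<exists>W. open W \<and> x \<in> W \<and> pos_def_C2_on W g"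
    proof cases
      case 1
      have "V \<subseteq> U" using V(4) closure_subset by blast
      then have "pos_def_C2_on V (\<lambda>x. reg_max e (f x) (G x))"
        by (intro pos_def_C2_on_reg_max V(1) e(1) pos_def_C2_on_subset[OF f]
            pos_def_C2_on_subset[OF G(1)] subset_UNIV)
      then have "pos_def_C2_on V g"
        by (rule pos_def_C2_on_cong[OF V(1), rotated]) (simp add: g_def)
      then show ?thesis using 1 V(1) by blast
    next
      case 2
      have "pos_def_C2_on (- closure V) g"
        by (rule pos_def_C2_on_cong[OF _ _ pos_def_C2_on_subset[OF G(1) subset_UNIV]])
          (use closure_subset[of V] in \<open>auto simp: g_def\<close>)
      then show ?thesis using 2 by blast
    next
      case 3
      \<comment> \<open>On this neighbourhood of \<open>x\<close> both branches of \<open>g\<close>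
        equal \<open>G\<close>: outside \<open>V\<close> by definition, inside \<open>V\<close>
        because \<open>G\<close> exceeds \<open>f\<close> by more than \<open>e\<close>.\<close>
      let ?W = "U \<inter> (\<lambda>x. G x - f x) -` {e<..}"
      have "open ?W"
        by (intro continuous_open_preimage continuous_intros contf contG assms(2) open_greaterThan)
      moreover have "x \<in> ?W"
        using 3 e2(2)[of x] e frontier(2) by auto
      moreover have "pos_def_C2_on ?W g"
        by (rule pos_def_C2_on_cong[OF \<open>open ?W\<close> _ pos_def_C2_on_subset[OF G(1) subset_UNIV]])
          (auto simp: g_def reg_max_eq(2)[OF e(1)])
      ultimately show ?thesis by blast
    qed
  qed
  moreover have "g x = f x" if "x \<in> \<Omega>" for x
    using V(2) e e1(2)[OF that] reg_max_eq(1)[OF e(1), of "G x" "f x"] that by (auto simp: g_def)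
  moreover have "C2_function_on (convex hull \<Omega>) g"
    using g_pd unfolding pos_def_C2_on_def C2_function_on_def by (intro exI[of _ UNIV]) simp
  ultimately show ?thesis
    by (intro exI[of _ g]) (simp add: pos_def_C2_on_def)
qed

end
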